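(* Consider the general network interaction model described in the context, with $n=|\mathcal{I}|$. Assume that the treatments $\{D_k\}_{k\in\mathcal{I}\cup\mathcal{J}}$ are mutually independent with $\Pr(D_i=d)=p_d^{\mathcal{I}}$ for $i\in\mathcal{I}$ and $\Pr(D_j=d)=p_d^{\mathcal{J}}$ for $j\in\mathcal{J}$, $d\in\{0,1\}$, and that for each $(d,r)\in\{0,1\}\times\mathcal{R}_i$, $(D_i,\boldsymbol{D}_{\mathcal{P}_i})$ is independent of $(Y_i(d,r),\boldsymbol{A}_{\mathcal{P}_i})$. Assume also that the potential outcomes $\{Y_i(d,r)\}_{(d,r)\in\{0,1\}\times\mathcal{R}_i}$ together with $\boldsymbol{A}_{\mathcal{P}_i}$ are independent across $i\in\mathcal{I}$ (not necessarily identically distributed). Suppose $(\beta_d^{ols},\beta_s^{ols})$ is determined (through a unique minimizer) by $$(\beta_0^{ols}, \beta_d^{ols}, \beta_s^{ols}) = \operatorname*{argmin}_{b_0, b_d, b_s\in\mathbb{R}} \sum_{i\in\mathcal{I}}\mathbb{E}[(Y_i - b_0 - b_d D_i - b_s M_i)^2].$$ Then $$\text{(i)}\quad \beta_d^{ols} = \frac{1}{n}\sum_{i\in\mathcal{I}} \sum_{(r, \vec{a}) \in \mathcal{R}_i \times \mathcal{A}_i} \mathbb{E}[\delta_i(r) \mid \boldsymbol{A}_{\mathcal{P}_i} = \vec{a}]\, \Pr(R_i = r, \boldsymbol{A}_{\mathcal{P}_i} = \vec{a}),$$ $$\text{(ii)}\quad \beta_s^{ols} = \frac{1}{n} \sum_{i\in\mathcal{I}}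 \sum_{(r, \vec{a}) \in \mathcal{R}_i \times \mathcal{A}_i} \pi_i(r, \vec{a}) \left\{ \mathbb{E}[\bar\tau_i^0(r) \mid \boldsymbol{A}_{\mathcal{P}_i} = \vec{a}] + \mathbb{E}[\bar Y_i(0) \mid \boldsymbol{A}_{\mathcal{P}_i} = \vec{a}] \right\},$$ where $$\pi_i(r, \vec{a}) := \frac{(M_i(r) - \mu) \Pr(R_i = r, \boldsymbol{A}_{\mathcal{P}_i} = \vec{a})}{n^{-1}\sum_{k\in\mathcal{I}} \mathbb{E}[(M_k - \mu)^2]},\qquad \mu := \frac{1}{n} \sum_{i\in\mathcal{I}} \mathbb{E}[M_i],\qquad \bar Y_i(0) := Y_i(1,0) p_1^{\mathcal{I}} + Y_i(0, 0) p_0^{\mathcal{I}}.$$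
   Context: General network model. There are two disjoint finite samples: the focal sample $\mathcal{I}$ and the peer sample $\mathcal{J}$. Each $i\in\mathcal{I}$ has a fixed (non-random) set of potential peers $\mathcal{P}_i=\{1(i),\ldots,n_i(i)\}\subseteq\mathcal{J}$ with $n_i=|\mathcal{P}_i|\ge 1$, possibly varying with $i$; the sets $\mathcal{P}_i$ and $\mathcal{P}_{i'}$ are disjoint for $i\ne i'$. Each unit $k\in\mathcal{I}\cup\mathcal{J}$ has a random treatment $D_k\in\{0,1\}$; put $\boldsymbol{D}_{\mathcal{P}_i}=(D_{1(i)},\ldots,D_{n_i(i)})^\top$. Link connections are the random vector $\boldsymbol{A}_{\mathcal{P}_i}=(A_{1(i)},\ldots,A_{n_i(i)})^\top$ with values in $\mathcal{A}_i:=\{0,1\}^{n_i}$, where $A_{j(i)}=1$ means the treatment of the $j$-th peer affects $i$'s outcome. The number of treated effective peers is $R_i:=\boldsymbol{A}_{\mathcal{P}_i}^\top\boldsymbol{D}_{\mathcal{P}_i}\in\mathcal{R}_i:=\{0,1,\ldots,n_i\}$. For $(d,r)\in\{0,1\}\times\mathcal{R}_i$, $Y_i(d,r)$ is a real random variable (potential outcome), and the observed outcome is $Y_i=\sum_{(d,r)\in\{0,1\}\times\mathcal{R}_i}\mathbf{1}\{D_i=d,R_i=r\}Y_i(d,r)$. For each $i$, $M_i:\mathcal{R}_i\to\mathbb{R}$ is a known (deterministic) non-decreasing function; when written without argument, $M_i$ denotes the random variable $M_i(R_i)$. Experimental design: the treatments $\{D_k\}_{k\in\mathcal{I}\cup\mathcal{J}}$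 are mutually independent with $\Pr(D_i=d)=p_d^{\mathcal{I}}$ for $i\in\mathcal{I}$ and $\Pr(D_j=d)=p_d^{\mathcal{J}}$ for $j\in\mathcal{J}$, $d\in\{0,1\}$. In addition, for each $(d,r)\in\{0,1\}\times\mathcal{R}_i$, $(D_i,\boldsymbol{D}_{\mathcal{P}_i})$ is independent of $(Y_i(d,r),\boldsymbol{A}_{\mathcal{P}_i})$. Independence across units: the potential outcomes $\{Y_i(d,r)\}_{(d,r)\in\{0,1\}\times\mathcal{R}_i}$ together with $\boldsymbol{A}_{\mathcal{P}_i}$ are independent across $i\in\mathcal{I}$ (not necessarily identically distributed). Dependence between $\boldsymbol{A}_{\mathcal{P}_i}$ and the potential outcomes of $i$ is allowed. Potential outcomes have finite second moments. A term consisting of a conditional expectation given a null event multiplied by a zero weight is read as $0$. Effects: $\delta_i(r):=Y_i(1,r)-Y_i(0,r)$, $\tau_i^0(d,r):=Y_i(d,r)-Y_i(d,0)$, $\bar\tau_i^0(r):=\tau_i^0(1,r)p_1^{\mathcal{I}}+\tau_i^0(0,r)p_0^{\mathcal{I}}$. *)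

theory Defs
  imports "HOL-Probability.Probability"
begin

text \<open>
  Binary vectors of length \<open>m\<close> (the sets \<open>\<A>\<^sub>i = {0,1}\<^bsup>n\<^sub>i\<^esup>\<close> with \<open>m = n\<^sub>i\<close>) are functions on
  \<open>{1..m}\<close>, extensional so that equality of vectors is equality of their \<open>m\<close> coordinates.
\<close>

definition bin_vecs :: "nat \<Rightarrow> (nat \<Rightarrow> nat) set" where
  "bin_vecs m = {1..m} \<rightarrow>\<^sub>E {0, 1}"

text \<open>
  \<open>I\<close> and \<open>J\<close> are the focal and the peer sample; \<open>peer i j\<close> is the unit \<open>j(i)\<close> for \<open>j \<in> {1..n i}\<close>;
  \<open>A i \<omega>\<close> is the whole link vector of the potential peers of \<open>i\<close>; \<open>Y i d r\<close> is the potential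
  outcome \<open>Y\<^sub>i(d,r)\<close>.  Nothing is assumed about \<open>n\<close>, \<open>peer\<close>, \<open>D\<close>, \<open>A\<close>, \<open>Y\<close>, \<open>M\<close> outside the
  stated index ranges.  Measurability into a \<open>count_space\<close> includes that all
  values lie in the indicated finite set.
\<close>

locale network_model = prob_space \<Omega>
  for \<Omega> :: "'w measure"
    and I J :: "'u set"
    and n :: "'u \<Rightarrow> nat"
    and peer :: "'u \<Rightarrow> nat \<Rightarrow> 'u"
    and D :: "'u \<Rightarrow> 'w \<Rightarrow> nat"
    and A :: "'u \<Rightarrow> 'w \<Rightarrow> (nat \<Rightarrow> nat)"
    and Y :: "'u \<Rightarrow> nat \<Rightarrow> nat \<Rightarrow> 'w \<Rightarrow> real"
    and M :: "'u \<Rightarrow> nat \<Rightarrow> real" +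
  assumes finite_focal: "finite I"
    and finite_peer: "finite J"
    and samples_disjoint: "I \<inter> J = {}"
    and n_pos: "\<And>i. i \<in> I \<Longrightarrow> 1 \<le> n i"
    and peer_inj: "\<And>i. i \<in> I \<Longrightarrow> inj_on (peer i) {1..n i}"
    and peers_subset: "\<And>i. i \<in> I \<Longrightarrow> peer i ` {1..n i} \<subseteq> J"
    and peers_disjoint: "disjoint_family_on (\<lambda>i. peer i ` {1..n i}) I"
    and D_rv: "\<And>k. k \<in> I \<union> J \<Longrightarrow> D k \<in> measurable \<Omega> (count_space {0, 1})"
    and A_rv: "\<And>i. i \<in> I \<Longrightarrow> A i \<in> measurable \<Omega> (count_space (bin_vecs (n i)))"
    and Y_rv: "\<And>i d r. i \<in> I \<Longrightarrow> d \<in> {0, 1} \<Longrightarrow> r \<in> {0..n i} \<Longrightarrow>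
                 Y i d r \<in> borel_measurable \<Omega>"
    and Y_sq_integrable: "\<And>i d r. i \<in> I \<Longrightarrow> d \<in> {0, 1} \<Longrightarrow> r \<in> {0..n i} \<Longrightarrow>
                 integrable \<Omega> (\<lambda>\<omega>. (Y i d r \<omega>)\<^sup>2)"
    and M_mono: "\<And>i. i \<in> I \<Longrightarrow> mono_on {0..n i} (M i)"

definition peer_treatments ::
    "('u \<Rightarrow> nat) \<Rightarrow> ('u \<Rightarrow> nat \<Rightarrow> 'u) \<Rightarrow> ('u \<Rightarrow> 'w \<Rightarrow> nat) \<Rightarrow> 'u \<Rightarrow> 'w \<Rightarrow> (nat \<Rightarrow> nat)" where
  "peer_treatments n peer D i \<omega> = (\<lambda>j\<in>{1..n i}. D (peer i j) \<omega>)"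

definition treated_peers ::
    "('u \<Rightarrow> nat) \<Rightarrow> ('u \<Rightarrow> nat \<Rightarrow> 'u) \<Rightarrow> ('u \<Rightarrow> 'w \<Rightarrow> nat) \<Rightarrow> ('u \<Rightarrow> 'w \<Rightarrow> (nat \<Rightarrow> nat)) \<Rightarrow>
     'u \<Rightarrow> 'w \<Rightarrow> nat" where
  "treated_peers n peer D A i \<omega> = (\<Sum>j = 1..n i. A i \<omega> j * peer_treatments n peer D i \<omega> j)"

definition observed_outcome ::
    "('u \<Rightarrow> nat) \<Rightarrow> ('u \<Rightarrow> nat \<Rightarrow> 'u) \<Rightarrow> ('u \<Rightarrow> 'w \<Rightarrow> nat) \<Rightarrow> ('u \<Rightarrow> 'w \<Rightarrow> (nat \<Rightarrow> nat)) \<Rightarrow>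
     ('u \<Rightarrow> nat \<Rightarrow> nat \<Rightarrow> 'w \<Rightarrow> real) \<Rightarrow> 'u \<Rightarrow> 'w \<Rightarrow> real" where
  "observed_outcome n peer D A Y i \<omega> =
     (\<Sum>(d, r)\<in>{0, 1} \<times> {0..n i}.
        of_bool (D i \<omega> = d \<and> treated_peers n peer D A i \<omega> = r) * Y i d r \<omega>)"

definition ols_objective ::
    "'w measure \<Rightarrow> 'u set \<Rightarrow> ('u \<Rightarrow> nat) \<Rightarrow> ('u \<Rightarrow> nat \<Rightarrow> 'u) \<Rightarrow> ('u \<Rightarrow> 'w \<Rightarrow> nat) \<Rightarrow>
     ('u \<Rightarrow> 'w \<Rightarrow> (nat \<Rightarrow> nat)) \<Rightarrow> ('u \<Rightarrow> nat \<Rightarrow> nat \<Rightarrow> 'w \<Rightarrow> real) \<Rightarrow> ('u \<Rightarrow> nat \<Rightarrow> real) \<Rightarrow>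
     real \<times> real \<times> real \<Rightarrow> real" where
  "ols_objective \<Omega> I n peer D A Y M = (\<lambda>(b0, bd, bs).
     \<Sum>i\<in>I. \<integral>\<omega>. (observed_outcome n peer D A Y i \<omega> - b0 - bd * real (D i \<omega>)
                   - bs * M i (treated_peers n peer D A i \<omega>))\<^sup>2 \<partial>\<Omega>)"

text \<open>
  Elementary conditional expectation given an event; it is \<open>0\<close> for a null event, since
  \<open>x / 0 = 0\<close>.  (In the theorem such terms always carry the weight \<open>0\<close>.)
\<close>

definition cond_expectation :: "'w measure \<Rightarrow> ('w \<Rightarrow> real) \<Rightarrow> 'w set \<Rightarrow> real" where
  "cond_expectation \<Omega> X E = (LINT \<omega>:E|\<Omega>. X \<omega>) / measure \<Omega> E"

definition direct_effect :: "('u \<Rightarrow> nat \<Rightarrow> nat \<Rightarrow> 'w \<Rightarrow> real) \<Rightarrow> 'u \<Rightarrow> nat \<Rightarrow> 'w \<Rightarrow> real" where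
  "direct_effect Y i r \<omega> = Y i 1 r \<omega> - Y i 0 r \<omega>"

definition spillover_effect ::
    "('u \<Rightarrow> nat \<Rightarrow> nat \<Rightarrow> 'w \<Rightarrow> real) \<Rightarrow> 'u \<Rightarrow> nat \<Rightarrow> nat \<Rightarrow> 'w \<Rightarrow> real" where
  "spillover_effect Y i d r \<omega> = Y i d r \<omega> - Y i d 0 \<omega>"

definition mean_spillover_effect ::
    "('u \<Rightarrow> nat \<Rightarrow> nat \<Rightarrow> 'w \<Rightarrow> real) \<Rightarrow> (nat \<Rightarrow> real) \<Rightarrow> 'u \<Rightarrow> nat \<Rightarrow> 'w \<Rightarrow> real" where
  "mean_spillover_effect Y pI i r \<omega> =
     spillover_effect Y i 1 r \<omega> * pI 1 + spillover_effect Y i 0 r \<omega> * pI 0"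

definition mean_baseline ::
    "('u \<Rightarrow> nat \<Rightarrow> nat \<Rightarrow> 'w \<Rightarrow> real) \<Rightarrow> (nat \<Rightarrow> real) \<Rightarrow> 'u \<Rightarrow> 'w \<Rightarrow> real" where
  "mean_baseline Y pI i \<omega> = Y i 1 0 \<omega> * pI 1 + Y i 0 0 \<omega> * pI 0"

definition mean_exposure ::
    "'w measure \<Rightarrow> 'u set \<Rightarrow> ('u \<Rightarrow> 'w \<Rightarrow> nat) \<Rightarrow> ('u \<Rightarrow> nat \<Rightarrow> real) \<Rightarrow> real" where
  "mean_exposure \<Omega> I R M = 1 / real (card I) * (\<Sum>i\<in>I. \<integral>\<omega>. M i (R i \<omega>) \<partial>\<Omega>)"

definition exposure_weight ::
    "'w measure \<Rightarrow> 'u set \<Rightarrow> ('u \<Rightarrow> 'w \<Rightarrow> nat) \<Rightarrow> ('u \<Rightarrow> 'w \<Rightarrow> (nat \<Rightarrow> nat)) \<Rightarrow>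
     ('u \<Rightarrow> nat \<Rightarrow> real) \<Rightarrow> 'u \<Rightarrow> nat \<Rightarrow> (nat \<Rightarrow> nat) \<Rightarrow> real" where
  "exposure_weight \<Omega> I R A M i r a =
     (M i r - mean_exposure \<Omega> I R M) * \<P>(\<omega> in \<Omega>. R i \<omega> = r \<and> A i \<omega> = a) /
     (1 / real (card I) * (\<Sum>k\<in>I. \<integral>\<omega>. (M k (R k \<omega>) - mean_exposure \<Omega> I R M)\<^sup>2 \<partial>\<Omega>))"

end

theory Submission
  imports Defs
begin

text \<open>
  The objective is a quadratic polynomial along every line through its minimizer, so its linear
  coefficient there vanishes, and uniqueness of the minimizer makes the quadratic coefficient
  nonzero.  Only two directions are needed: \<open>(-p\<^sub>1, 1, 0)\<close> and \<open>(-\<mu>, 0, 1)\<close>, whose regressors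
  \<open>D\<^sub>i - p\<^sub>1\<close> and \<open>M\<^sub>i - \<mu>\<close> are centred and orthogonal after summing over \<open>i\<close>, because \<open>D\<^sub>i\<close> is
  independent of \<open>R\<^sub>i\<close> and \<open>p\<^sub>1\<close> is common to all units.  This decouples the two coefficients;
  the remaining covariances with \<open>Y\<^sub>i\<close> are computed on the cells \<open>{D\<^sub>i = d, R\<^sub>i = r, A\<^sub>i = a}\<close>,
  where \<open>R\<^sub>i\<close> is a function of the treatments of the peers alone.
\<close>

section \<open>Optimality of a unique minimizer along a line\<close>

text \<open>Minimality makes the increment \<open>t\<^sup>2 * q - 2 * t * l\<close> nonnegative for
  every \<open>t\<close>, which a small \<open>t\<close> of the sign of \<open>l\<close> would
  violate. Once \<open>l = 0\<close>, having \<open>q = 0\<close> as well would make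
  \<open>f\<close> constant along the line, with \<open>b + h\<close> a second minimizer.\<close>

lemma unique_min_along_line:
  fixes f :: "'a::real_vector \<Rightarrow> real"
  assumes line: "\<And>t. f (b + t *\<^sub>R h) = f b - 2 * t * l + t\<^sup>2 * q"
    and min: "is_arg_min f (\<lambda>_. True) b"
    and unique: "\<And>c. is_arg_min f (\<lambda>_. True) c \<Longrightarrow> c = b"
    and h: "h \<noteq> 0"
  shows "l = 0" and "q \<noteq> 0"
proof -
  have ge: "0 \<le> t\<^sup>2 * q - 2 * t * l" for t
    using min line[of t] by (auto simp: is_arg_min_def not_less dest: spec[of _ "b + t *\<^sub>R h"])
  show l: "l = 0"
  proof (rule ccontr)
    assume "l \<noteq> 0"
    \<comment> \<open>The vertex \<open>l / q\<close> is no safe test point, since \<open>q\<close>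
      may be zero or negative. With a positive \<open>s > q\<close> in its place, the increment at
      \<open>t = l / s\<close> is strictly negative.\<close>
    define s where "s = \<bar>q\<bar> + 1"
    have s: "s > 0" "q < s" by (auto simp: s_def)
    have "0 \<le> (l / s)\<^sup>2 * q - 2 * (l / s) * l" by (rule ge)
    also have "\<dots> = l\<^sup>2 * (q - 2 * s) / s\<^sup>2"
      using s by (simp add: field_simps power2_eq_square)
    also have "\<dots> < 0"
      using s \<open>l \<noteq> 0\<close> by (intro divide_neg_pos mult_pos_neg) auto
    finally show False by simp
  qed
  show "q \<noteq> 0"
  proof
    assume "q = 0"
    then have "f (b + h) = f b" using line[of 1] l by simp
    then have "is_arg_min f (\<lambda>_. True) (b + h)" using min by (simp add: is_arg_min_def)
    then show False using unique h by fastforce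
  qed
qed

section \<open>Binary vectors and the randomized design\<close>

lemma finite_bin_vecs [simp]: "finite (bin_vecs m)"
  by (simp add: bin_vecs_def finite_PiE)

text \<open>The product form lets measurability of vector-valued maps be checked by coordinates; the
  discrete form makes every predicate on vectors measurable.\<close>

lemma count_space_bin_vecs: "count_space (bin_vecs m) = (\<Pi>\<^sub>M j\<in>{1..m}. count_space {0, 1})"
  unfolding bin_vecs_def by (rule count_space_PiM_finite [symmetric]) auto

text \<open>The cast \<open>real (D i \<omega>)\<close> gives the treatment pair the same type as
  the pair \<open>(Y i d r \<omega>, A i \<omega>)\<close>, as \<open>indep_var\<close> demands of
  its two variables. A single \<open>pI\<close> serves all focal units, which is what later
  decouples the sums over \<open>i\<close>.\<close>

locale randomized_network = network_model \<Omega> I J n peer D A Y M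
  for \<Omega> :: "'w measure"
    and I J :: "'u set"
    and n :: "'u \<Rightarrow> nat"
    and peer :: "'u \<Rightarrow> nat \<Rightarrow> 'u"
    and D :: "'u \<Rightarrow> 'w \<Rightarrow> nat"
    and A :: "'u \<Rightarrow> 'w \<Rightarrow> (nat \<Rightarrow> nat)"
    and Y :: "'u \<Rightarrow> nat \<Rightarrow> nat \<Rightarrow> 'w \<Rightarrow> real"
    and M :: "'u \<Rightarrow> nat \<Rightarrow> real" +
  fixes pI :: "nat \<Rightarrow> real"
  assumes treatments_indep: "indep_vars (\<lambda>_. count_space {0, 1}) D (I \<union> J)"
    and prob_focal: "\<And>i d. i \<in> I \<Longrightarrow> d \<in> {0, 1} \<Longrightarrow> \<P>(\<omega> in \<Omega>. D i \<omega> = d) = pI d"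
    and randomization:
      "\<And>i d r. i \<in> I \<Longrightarrow> d \<in> {0, 1} \<Longrightarrow> r \<in> {0..n i} \<Longrightarrow>
         indep_var (count_space {0, 1} \<Otimes>\<^sub>M count_space (bin_vecs (n i)))
           (\<lambda>\<omega>. (real (D i \<omega>), peer_treatments n peer D i \<omega>))
           (borel \<Otimes>\<^sub>M count_space (bin_vecs (n i)))
           (\<lambda>\<omega>. (Y i d r \<omega>, A i \<omega>))"
begin

abbreviation "T \<equiv> peer_treatments n peer D"
abbreviation "R \<equiv> treated_peers n peer D A"

section \<open>Ranges, measurability and cell events\<close>

lemma D_range: "k \<in> I \<union> J \<Longrightarrow> \<omega> \<in> space \<Omega> \<Longrightarrow> D k \<omega> \<in> {0, 1}"
  using measurable_space[OF D_rv] by auto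

lemma A_range: "i \<in> I \<Longrightarrow> \<omega> \<in> space \<Omega> \<Longrightarrow> A i \<omega> \<in> bin_vecs (n i)"
  using measurable_space[OF A_rv] by auto

lemma peer_in_J: "i \<in> I \<Longrightarrow> j \<in> {1..n i} \<Longrightarrow> peer i j \<in> J"
  using peers_subset by blast

lemma R_range:
  assumes "i \<in> I" "\<omega> \<in> space \<Omega>"
  shows "R i \<omega> \<in> {0..n i}"
proof -
  have "A i \<omega> j * T i \<omega> j \<le> 1" if j: "j \<in> {1..n i}" for j
  proof -
    have "A i \<omega> j \<in> {0, 1}" using A_range[OF assms] j by (auto simp: bin_vecs_def)
    moreover have "T i \<omega> j \<in> {0, 1}"
      using D_range[of "peer i j"] peer_in_J[OF assms(1) j] assms j by (auto simp: peer_treatments_def)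
    ultimately show ?thesis by auto
  qed
  then have "R i \<omega> \<le> (\<Sum>j = 1..n i. 1)" unfolding treated_peers_def by (intro sum_mono)
  then show ?thesis by simp
qed

lemma D_measurable [measurable]: "i \<in> I \<Longrightarrow> D i \<in> measurable \<Omega> (count_space {0, 1})"
  using D_rv by blast

lemma T_measurable [measurable]: "i \<in> I \<Longrightarrow> T i \<in> measurable \<Omega> (count_space (bin_vecs (n i)))"
  unfolding count_space_bin_vecs peer_treatments_def
  by (intro measurable_restrict D_rv) (simp add: peer_in_J)

lemma A_measurable [measurable]: "i \<in> I \<Longrightarrow> A i \<in> measurable \<Omega> (count_space (bin_vecs (n i)))"
  using A_rv .

lemma A_event [measurable]: "i \<in> I \<Longrightarrow> {\<omega> \<in> space \<Omega>. A i \<omega> = a} \<in> sets \<Omega>"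
  using measurable_compose[OF A_rv, of i "\<lambda>b. b = a" "count_space UNIV"]
  by (simp add: pred_def)

text \<open>Jointly, \<open>D i\<close>, \<open>T i\<close> and \<open>A i\<close> map into a finite
  discrete space, so every predicate of the three is an event; \<open>R i\<close> enters as a
  function of \<open>T i\<close> and \<open>A i\<close>.\<close>

lemma cell_event [measurable]:
  assumes i [measurable]: "i \<in> I"
  shows "{\<omega> \<in> space \<Omega>. D i \<omega> = d \<and> R i \<omega> = r \<and> A i \<omega> = a} \<in> sets \<Omega>"
proof -
  have "{\<omega> \<in> space \<Omega>. P (D i \<omega>) (T i \<omega>) (A i \<omega>)} \<in> sets \<Omega>"
    for P :: "nat \<Rightarrow> (nat \<Rightarrow> nat) \<Rightarrow> (nat \<Rightarrow> nat) \<Rightarrow> bool"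
  proof -
    have "(\<lambda>\<omega>. (D i \<omega>, T i \<omega>, A i \<omega>)) \<in> measurable \<Omega>
        (count_space ({0, 1} \<times> bin_vecs (n i) \<times> bin_vecs (n i)))"
      using D_measurable[OF i] T_measurable[OF i] A_measurable[OF i]
      by (simp add: pair_measure_count_space[symmetric] del: One_nat_def)
    from measurable_compose[OF this, of "\<lambda>(d, t, a). P d t a" "count_space UNIV"]
    show ?thesis by (simp add: pred_def)
  qed
  from this[of "\<lambda>d' t b. d' = d \<and> (\<Sum>j = 1..n i. b j * t j) = r \<and> b = a"]
  show ?thesis by (simp add: treated_peers_def)
qed

section \<open>Factorization over treatments and links\<close>

text \<open>A focal unit is never its own peer, because the samples are disjoint. Hence mutual
  independence of the treatments applies to the disjoint index sets \<open>{i}\<close> and the peers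
  of \<open>i\<close>.\<close>

lemma prob_D_T:
  assumes i: "i \<in> I" and d: "d \<in> {0, 1}"
  shows "\<P>(\<omega> in \<Omega>. D i \<omega> = d \<and> P (T i \<omega>)) = pI d * \<P>(\<omega> in \<Omega>. P (T i \<omega>))"
proof -
  let ?P = "peer i ` {1..n i}"
  \<comment> \<open>Restricting the treatments to the peers gives a family indexed by units;
    \<open>?reindex\<close> turns it into the vector \<open>T i\<close>, indexed by
    positions.\<close>
  let ?reindex = "\<lambda>x. \<lambda>j\<in>{1..n i}. x (peer i j)"
  have sub: "{i} \<inter> ?P = {}" "{i} \<subseteq> I \<union> J" "?P \<subseteq> I \<union> J"
    using i peers_subset[OF i] samples_disjoint by blast+
  have "(\<lambda>x. x i) \<in> measurable (\<Pi>\<^sub>M _\<in>{i}. count_space {0, 1::nat}) (count_space {0, 1})"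
    by (rule measurable_component_singleton) simp
  then have proj: "(\<lambda>x. x i = d) \<in> measurable (\<Pi>\<^sub>M _\<in>{i}. count_space {0, 1}) (count_space UNIV)"
    by (rule measurable_compose) simp
  have "?reindex \<in> measurable (\<Pi>\<^sub>M _\<in>?P. count_space {0, 1::nat}) (count_space (bin_vecs (n i)))"
    unfolding count_space_bin_vecs
    by (intro measurable_restrict measurable_component_singleton) auto
  then have reindex: "(\<lambda>x. P (?reindex x)) \<in> measurable (\<Pi>\<^sub>M _\<in>?P. count_space {0, 1}) (count_space UNIV)"
    by (rule measurable_compose) simp
  have "(\<lambda>x. x i = d) \<circ> (\<lambda>\<omega>. restrict (\<lambda>k. D k \<omega>) {i}) = (\<lambda>\<omega>. D i \<omega> = d)"
    "(\<lambda>x. P (?reindex x)) \<circ> (\<lambda>\<omega>. restrict (\<lambda>k. D k \<omega>) ?P) = (\<lambda>\<omega>. P (T i \<omega>))"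
    by (auto simp: peer_treatments_def fun_eq_iff restrict_def intro!: arg_cong[of _ _ P])
  with indep_var_compose[OF indep_var_restrict[OF treatments_indep sub] proj reindex]
  have "indep_var (count_space UNIV) (\<lambda>\<omega>. D i \<omega> = d) (count_space UNIV) (\<lambda>\<omega>. P (T i \<omega>))"
    by simp
  from indep_varD[OF this, of "{True}" "{True}"]
  have "prob {\<omega> \<in> space \<Omega>. D i \<omega> = d \<and> P (T i \<omega>)} =
      prob {\<omega> \<in> space \<Omega>. D i \<omega> = d} * prob {\<omega> \<in> space \<Omega>. P (T i \<omega>)}"
    by (simp add: vimage_def Int_def conj_commute)
  then show ?thesis using prob_focal[OF i d] by simp
qed

text \<open>Fixing \<open>A i = a\<close> turns \<open>R i = r\<close> into a condition on
  \<open>T i\<close> alone, so the integrand is a function of \<open>(D i, T i)\<close> times a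
  function of \<open>(X, A i)\<close>. The independence \<open>indep\<close> separates the two,
  \<open>prob_D_T\<close> splits off \<open>pI d\<close>, and a second use of \<open>indep\<close>
  reassembles the joint probability of \<open>R i = r\<close> and \<open>A i = a\<close>.\<close>

lemma cell_expectation:
  assumes i: "i \<in> I" and d: "d \<in> {0, 1}" and a: "a \<in> bin_vecs (n i)"
    and X: "integrable \<Omega> X"
    and indep: "indep_var (count_space {0, 1} \<Otimes>\<^sub>M count_space (bin_vecs (n i)))
           (\<lambda>\<omega>. (real (D i \<omega>), T i \<omega>))
           (borel \<Otimes>\<^sub>M count_space (bin_vecs (n i))) (\<lambda>\<omega>. (X \<omega>, A i \<omega>))"
  shows "expectation (\<lambda>\<omega>. of_bool (D i \<omega> = d \<and> R i \<omega> = r \<and> A i \<omega> = a) * X \<omega>) =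
      pI d * \<P>(\<omega> in \<Omega>. R i \<omega> = r \<and> A i \<omega> = a) * cond_expectation \<Omega> X {\<omega> \<in> space \<Omega>. A i \<omega> = a}"
proof -
  let ?E = "{\<omega> \<in> space \<Omega>. A i \<omega> = a}"
  \<comment> \<open>\<open>s\<close> is the condition \<open>R i = r\<close> with the links frozen
    at \<open>a\<close>.\<close>
  define s where "s t \<longleftrightarrow> (\<Sum>j = 1..n i. a j * t j) = r" for t :: "nat \<Rightarrow> nat"
  \<comment> \<open>With \<open>g\<close> the identity this separates the outcome; with
    \<open>g\<close> constantly 1 it yields the product rule for events of \<open>T i\<close> and
    \<open>A i\<close>.\<close>
  have factor: "expectation (\<lambda>\<omega>. of_bool (P (real (D i \<omega>)) (T i \<omega>)) * (g (X \<omega>) * of_bool (A i \<omega> = a))) =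
      prob {\<omega> \<in> space \<Omega>. P (real (D i \<omega>)) (T i \<omega>)} * expectation (\<lambda>\<omega>. g (X \<omega>) * of_bool (A i \<omega> = a))"
    if g: "g \<in> borel_measurable borel" and int: "integrable \<Omega> (\<lambda>\<omega>. g (X \<omega>))" for g P
  proof -
    let ?S = "count_space {0, 1::real} \<Otimes>\<^sub>M count_space (bin_vecs (n i))"
    have h: "(\<lambda>(x, t). of_bool (P x t) :: real) \<in> borel_measurable ?S"
      by (simp add: pair_measure_count_space)
    have k: "(\<lambda>(x, b). g x * of_bool (b = a)) \<in> borel_measurable (borel \<Otimes>\<^sub>M count_space (bin_vecs (n i)))"
      using g by measurable
    have "random_variable ?S (\<lambda>\<omega>. (real (D i \<omega>), T i \<omega>))"
      by (rule indep_var_rv1[OF indep])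
    from measurable_compose[OF this h]
    have hm: "(\<lambda>\<omega>. of_bool (P (real (D i \<omega>)) (T i \<omega>)) :: real) \<in> borel_measurable \<Omega>" by simp
    have hi: "integrable \<Omega> (\<lambda>\<omega>. of_bool (P (real (D i \<omega>)) (T i \<omega>)) :: real)"
      by (rule integrable_const_bound[where B=1]) (use hm in auto)
    have ind: "(\<lambda>\<omega>. of_bool (A i \<omega> = a) :: real) \<in> borel_measurable \<Omega>"
      using measurable_compose[OF A_measurable[OF i], of "\<lambda>b. of_bool (b = a) :: real" borel] by simp
    have ki: "integrable \<Omega> (\<lambda>\<omega>. g (X \<omega>) * of_bool (A i \<omega> = a))"
      by (rule Bochner_Integration.integrable_bound[OF int]) (use ind int in \<open>auto intro!: borel_measurable_times\<close>)
    have "{\<omega> \<in> space \<Omega>. P (real (D i \<omega>)) (T i \<omega>)} =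
        (\<lambda>\<omega>. of_bool (P (real (D i \<omega>)) (T i \<omega>)) :: real) -` {1} \<inter> space \<Omega>" by auto
    then have ev: "{\<omega> \<in> space \<Omega>. P (real (D i \<omega>)) (T i \<omega>)} \<in> sets \<Omega>"
      using measurable_sets[OF hm, of "{1}"] by simp
    have "expectation (\<lambda>\<omega>. of_bool (P (real (D i \<omega>)) (T i \<omega>)) :: real) =
        expectation (indicator {\<omega> \<in> space \<Omega>. P (real (D i \<omega>)) (T i \<omega>)})"
      by (intro Bochner_Integration.integral_cong) (auto simp: indicator_def)
    also have "\<dots> = prob {\<omega> \<in> space \<Omega>. P (real (D i \<omega>)) (T i \<omega>)}"
      using ev by simp
    finally have "expectation (\<lambda>\<omega>. of_bool (P (real (D i \<omega>)) (T i \<omega>)) :: real) =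
        prob {\<omega> \<in> space \<Omega>. P (real (D i \<omega>)) (T i \<omega>)}" .
    with indep_var_lebesgue_integral[OF _ hi ki] indep_var_compose[OF indep h k]
    show ?thesis by (simp add: comp_def)
  qed
  have condX: "expectation (\<lambda>\<omega>. X \<omega> * of_bool (A i \<omega> = a)) = (LINT \<omega>:?E|\<Omega>. X \<omega>)"
    unfolding set_lebesgue_integral_def
    by (intro Bochner_Integration.integral_cong) (auto simp: indicator_def)
  have R: "R i \<omega> = r \<and> A i \<omega> = a \<longleftrightarrow> s (T i \<omega>) \<and> A i \<omega> = a" for \<omega>
    by (auto simp: treated_peers_def s_def)
  have "expectation (\<lambda>\<omega>. of_bool (D i \<omega> = d \<and> R i \<omega> = r \<and> A i \<omega> = a) * X \<omega>) =
      expectation (\<lambda>\<omega>. of_bool (real (D i \<omega>) = real d \<and> s (T i \<omega>)) * (X \<omega> * of_bool (A i \<omega> = a)))"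
    by (intro Bochner_Integration.integral_cong) (simp_all add: R of_bool_def)
  also have "\<dots> = prob {\<omega> \<in> space \<Omega>. D i \<omega> = d \<and> s (T i \<omega>)} * (LINT \<omega>:?E|\<Omega>. X \<omega>)"
    using factor[of "\<lambda>x. x" "\<lambda>x t. x = real d \<and> s t"] X by (simp add: condX)
  also have "\<dots> = pI d * prob {\<omega> \<in> space \<Omega>. s (T i \<omega>)} * (LINT \<omega>:?E|\<Omega>. X \<omega>)"
    using prob_D_T[OF i d] by simp
  \<comment> \<open>On a null event both sides are 0: the integral because the integrand vanishes
    almost everywhere, the right side through its factor \<open>prob ?E\<close>.\<close>
  also have "(LINT \<omega>:?E|\<Omega>. X \<omega>) = prob ?E * cond_expectation \<Omega> X ?E"
  proof (cases "prob ?E = 0")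
    case True
    then have "AE \<omega> in \<Omega>. \<not> A i \<omega> = a"
      using A_event[OF i] by (subst AE_iff_measurable[OF A_event[OF i]]) (auto simp: emeasure_eq_measure)
    then have "AE \<omega> in \<Omega>. X \<omega> * of_bool (A i \<omega> = a) = 0" by eventually_elim auto
    then have "expectation (\<lambda>\<omega>. X \<omega> * of_bool (A i \<omega> = a)) = 0" by (rule integral_eq_zero_AE)
    then show ?thesis using True condX by simp
  qed (simp add: cond_expectation_def)
  also have "pI d * prob {\<omega> \<in> space \<Omega>. s (T i \<omega>)} * (prob ?E * cond_expectation \<Omega> X ?E) =
      pI d * (prob {\<omega> \<in> space \<Omega>. s (T i \<omega>)} * prob ?E) * cond_expectation \<Omega> X ?E" by simp
  also have "prob {\<omega> \<in> space \<Omega>. s (T i \<omega>)} * prob ?E = \<P>(\<omega> in \<Omega>. R i \<omega> = r \<and> A i \<omega> = a)"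
  proof -
    \<comment> \<open>Splitting by the two values of \<open>D i\<close> writes the event as a union
      of cells, already known to be measurable.\<close>
    have "{\<omega> \<in> space \<Omega>. R i \<omega> = r \<and> A i \<omega> = a} = (\<Union>d'\<in>{0, 1}. {\<omega> \<in> space \<Omega>. D i \<omega> = d' \<and> R i \<omega> = r \<and> A i \<omega> = a})"
      using D_range i by blast
    then have ev: "{\<omega> \<in> space \<Omega>. R i \<omega> = r \<and> A i \<omega> = a} \<in> sets \<Omega>"
      using cell_event[OF i] by simp
    have "\<P>(\<omega> in \<Omega>. R i \<omega> = r \<and> A i \<omega> = a) = expectation (indicator {\<omega> \<in> space \<Omega>. R i \<omega> = r \<and> A i \<omega> = a})"
      using ev by simp
    also have "\<dots> = expectation (\<lambda>\<omega>. of_bool (s (T i \<omega>)) * (1 * of_bool (A i \<omega> = a)))"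
      by (intro Bochner_Integration.integral_cong) (simp_all add: R indicator_def of_bool_def)
    also have "\<dots> = prob {\<omega> \<in> space \<Omega>. s (T i \<omega>)} * expectation (\<lambda>\<omega>. 1 * of_bool (A i \<omega> = a) :: real)"
      by (rule factor[of "\<lambda>_. 1" "\<lambda>_ t. s t"]) auto
    also have "expectation (\<lambda>\<omega>. 1 * of_bool (A i \<omega> = a) :: real) = expectation (indicator ?E)"
      by (intro Bochner_Integration.integral_cong) (auto simp: indicator_def)
    also have "\<dots> = prob ?E" using A_event[OF i] by simp
    finally show ?thesis by simp
  qed
  finally show ?thesis .
qed

section \<open>Decomposition of expectations into cells\<close>

text \<open>Every \<omega> lies in exactly one cell. The cells also record \<open>a\<close>, on
  which \<open>f\<close> does not depend, because the conditioning is on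
  \<open>A i = a\<close>.\<close>

lemma sum_cells:
  fixes f :: "nat \<Rightarrow> nat \<Rightarrow> real"
  assumes "i \<in> I" "\<omega> \<in> space \<Omega>"
  shows "f (D i \<omega>) (R i \<omega>) = (\<Sum>d\<in>{0, 1}. \<Sum>(r, a)\<in>{0..n i} \<times> bin_vecs (n i).
      of_bool (D i \<omega> = d \<and> R i \<omega> = r \<and> A i \<omega> = a) * f d r)"
proof -
  have "(\<Sum>d\<in>{0, 1}. \<Sum>(r, a)\<in>{0..n i} \<times> bin_vecs (n i).
        of_bool (D i \<omega> = d \<and> R i \<omega> = r \<and> A i \<omega> = a) * f d r) =
      (\<Sum>p\<in>{0, 1} \<times> {0..n i} \<times> bin_vecs (n i).
        if p = (D i \<omega>, R i \<omega>, A i \<omega>) then f (D i \<omega>) (R i \<omega>) else 0)"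
    unfolding sum.cartesian_product by (intro sum.cong) auto
  also have "\<dots> = f (D i \<omega>) (R i \<omega>)"
    using D_range[of i \<omega>] R_range[of i \<omega>] A_range[of i \<omega>] assms by (subst sum.delta) auto
  finally show ?thesis by simp
qed

lemma observed_outcome_eq:
  assumes "i \<in> I" "\<omega> \<in> space \<Omega>"
  shows "observed_outcome n peer D A Y i \<omega> = Y i (D i \<omega>) (R i \<omega>) \<omega>"
proof -
  have "observed_outcome n peer D A Y i \<omega> =
      (\<Sum>p\<in>{0, 1} \<times> {0..n i}. if p = (D i \<omega>, R i \<omega>) then Y i (D i \<omega>) (R i \<omega>) \<omega> else 0)"
    unfolding observed_outcome_def by (intro sum.cong) auto
  also have "\<dots> = Y i (D i \<omega>) (R i \<omega>) \<omega>"
    using D_range[of i \<omega>] R_range[of i \<omega>] assms by (subst sum.delta) auto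
  finally show ?thesis .
qed

text \<open>On a cell with labels \<open>d\<close> and \<open>r\<close> the observed outcome is the
  potential outcome \<open>Y i d r\<close>, so \<open>cell_expectation\<close> applies cell by cell.
  A general \<open>\<phi>\<close> covers functions of treatment and exposure, weighted outcomes and
  squared residuals at once.\<close>

lemma
  assumes i: "i \<in> I"
    and \<phi>: "\<And>d r. \<phi> d r \<in> borel_measurable borel"
    and int: "\<And>d r. d \<in> {0, 1} \<Longrightarrow> r \<in> {0..n i} \<Longrightarrow> integrable \<Omega> (\<lambda>\<omega>. \<phi> d r (Y i d r \<omega>))"
  shows integrable_observed:
      "integrable \<Omega> (\<lambda>\<omega>. \<phi> (D i \<omega>) (R i \<omega>) (observed_outcome n peer D A Y i \<omega>))" (is ?int)
    and expectation_observed: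
      "expectation (\<lambda>\<omega>. \<phi> (D i \<omega>) (R i \<omega>) (observed_outcome n peer D A Y i \<omega>)) =
        (\<Sum>d\<in>{0, 1}. \<Sum>(r, a)\<in>{0..n i} \<times> bin_vecs (n i). pI d * \<P>(\<omega> in \<Omega>. R i \<omega> = r \<and> A i \<omega> = a) *
          cond_expectation \<Omega> (\<lambda>\<omega>. \<phi> d r (Y i d r \<omega>)) {\<omega> \<in> space \<Omega>. A i \<omega> = a})" (is ?exp)
proof -
  define c where "c d r a \<omega> = of_bool (D i \<omega> = d \<and> R i \<omega> = r \<and> A i \<omega> = a) * \<phi> d r (Y i d r \<omega>)" for d r a \<omega>
  have eq: "\<phi> (D i \<omega>) (R i \<omega>) (observed_outcome n peer D A Y i \<omega>) =
      (\<Sum>d\<in>{0, 1}. \<Sum>p\<in>{0..n i} \<times> bin_vecs (n i). c d (fst p) (snd p) \<omega>)" if "\<omega> \<in> space \<Omega>" for \<omega>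
    using sum_cells[OF i that, of "\<lambda>d r. \<phi> d r (Y i d r \<omega>)"] observed_outcome_eq[OF i that]
    by (simp add: c_def case_prod_beta)
  have c_int: "integrable \<Omega> (c d r a)" if "d \<in> {0, 1}" "r \<in> {0..n i}" for d r a
  proof -
    have "integrable \<Omega> (\<lambda>\<omega>. indicator {\<omega> \<in> space \<Omega>. D i \<omega> = d \<and> R i \<omega> = r \<and> A i \<omega> = a} \<omega> * \<phi> d r (Y i d r \<omega>))"
      using integrable_mult_indicator[OF cell_event[OF i] int[OF that]] by simp
    also have "?this \<longleftrightarrow> ?thesis"
      by (intro Bochner_Integration.integrable_cong) (auto simp: c_def indicator_def)
    finally show ?thesis .
  qed
  have "integrable \<Omega> (\<lambda>\<omega>. \<Sum>d\<in>{0, 1}. \<Sum>p\<in>{0..n i} \<times> bin_vecs (n i). c d (fst p) (snd p) \<omega>)"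
    by (intro Bochner_Integration.integrable_sum c_int) auto
  also have "?this \<longleftrightarrow> ?int"
    by (intro Bochner_Integration.integrable_cong) (simp_all add: eq)
  finally show ?int .
  have cell: "expectation (c d r a) = pI d * \<P>(\<omega> in \<Omega>. R i \<omega> = r \<and> A i \<omega> = a) *
      cond_expectation \<Omega> (\<lambda>\<omega>. \<phi> d r (Y i d r \<omega>)) {\<omega> \<in> space \<Omega>. A i \<omega> = a}"
    if "d \<in> {0, 1}" "r \<in> {0..n i}" "a \<in> bin_vecs (n i)" for d r a
  proof -
    \<comment> \<open>Transforming only the outcome component keeps it paired with
      \<open>A i\<close>, so the independence in \<open>randomization\<close> passes to the
      transformed outcome.\<close>
    have "(\<lambda>(y, a). (\<phi> d r y, a)) \<in> measurable (borel \<Otimes>\<^sub>M count_space (bin_vecs (n i)))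
        (borel \<Otimes>\<^sub>M count_space (bin_vecs (n i)))"
      using \<phi> by measurable
    from indep_var_compose[OF randomization[OF i that(1,2)] measurable_ident this]
    have "indep_var (count_space {0, 1} \<Otimes>\<^sub>M count_space (bin_vecs (n i)))
        (\<lambda>\<omega>. (real (D i \<omega>), T i \<omega>))
        (borel \<Otimes>\<^sub>M count_space (bin_vecs (n i))) (\<lambda>\<omega>. (\<phi> d r (Y i d r \<omega>), A i \<omega>))"
      by (simp add: comp_def)
    from cell_expectation[OF i that(1,3) int[OF that(1,2)] this]
    show ?thesis unfolding c_def .
  qed
  have "expectation (\<lambda>\<omega>. \<phi> (D i \<omega>) (R i \<omega>) (observed_outcome n peer D A Y i \<omega>)) =
      expectation (\<lambda>\<omega>. \<Sum>d\<in>{0, 1}. \<Sum>p\<in>{0..n i} \<times> bin_vecs (n i). c d (fst p) (snd p) \<omega>)"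
    by (intro Bochner_Integration.integral_cong) (simp_all add: eq)
  also have "\<dots> = (\<Sum>d\<in>{0, 1}. expectation (\<lambda>\<omega>. \<Sum>p\<in>{0..n i} \<times> bin_vecs (n i). c d (fst p) (snd p) \<omega>))"
    by (intro Bochner_Integration.integral_sum Bochner_Integration.integrable_sum c_int) auto
  also have "\<dots> = (\<Sum>d\<in>{0, 1}. \<Sum>p\<in>{0..n i} \<times> bin_vecs (n i). expectation (c d (fst p) (snd p)))"
    by (intro sum.cong refl Bochner_Integration.integral_sum c_int) auto
  also have "\<dots> = (\<Sum>d\<in>{0, 1}. \<Sum>(r, a)\<in>{0..n i} \<times> bin_vecs (n i). pI d * \<P>(\<omega> in \<Omega>. R i \<omega> = r \<and> A i \<omega> = a) *
          cond_expectation \<Omega> (\<lambda>\<omega>. \<phi> d r (Y i d r \<omega>)) {\<omega> \<in> space \<Omega>. A i \<omega> = a})"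
    by (intro sum.cong refl) (auto simp: cell)
  finally show ?exp .
qed

section \<open>Moments of treatment, exposure and weighted outcome\<close>

lemma Y_integrable:
  assumes "i \<in> I" "d \<in> {0, 1}" "r \<in> {0..n i}"
  shows "integrable \<Omega> (Y i d r)"
  using square_integrable_imp_integrable[OF Y_rv[OF assms] Y_sq_integrable[OF assms]] .

lemma pI_sum:
  assumes i: "i \<in> I"
  shows "pI 0 + pI 1 = 1"
proof -
  have [measurable]: "{\<omega> \<in> space \<Omega>. D i \<omega> = d} \<in> sets \<Omega>" for d
    using measurable_compose[OF D_measurable[OF i], of "\<lambda>b. b = d" "count_space UNIV"]
    by (auto simp: pred_def)
  have "prob ({\<omega> \<in> space \<Omega>. D i \<omega> = 0} \<union> {\<omega> \<in> space \<Omega>. D i \<omega> = 1}) = pI 0 + pI 1"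
    using prob_focal[OF i] by (subst finite_measure_Union) auto
  also have "{\<omega> \<in> space \<Omega>. D i \<omega> = 0} \<union> {\<omega> \<in> space \<Omega>. D i \<omega> = 1} = space \<Omega>"
    using D_range i by auto
  finally show ?thesis by (simp add: prob_space)
qed

text \<open>Conditioning preserves a constant except on a null event, where the convention gives 0;
  the weight vanishes there too, since its event is contained in the conditioning event.\<close>

lemma prob_cell_const:
  assumes i: "i \<in> I"
  shows "\<P>(\<omega> in \<Omega>. R i \<omega> = r \<and> A i \<omega> = a) * cond_expectation \<Omega> (\<lambda>_. c) {\<omega> \<in> space \<Omega>. A i \<omega> = a} =
    \<P>(\<omega> in \<Omega>. R i \<omega> = r \<and> A i \<omega> = a) * c"
proof (cases "prob {\<omega> \<in> space \<Omega>. A i \<omega> = a} = 0")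
  case True
  have "\<P>(\<omega> in \<Omega>. R i \<omega> = r \<and> A i \<omega> = a) \<le> prob {\<omega> \<in> space \<Omega>. A i \<omega> = a}"
    by (intro finite_measure_mono A_event[OF i]) auto
  with True have "\<P>(\<omega> in \<Omega>. R i \<omega> = r \<and> A i \<omega> = a) = 0"
    by (simp add: measure_le_0_iff)
  then show ?thesis by simp
next
  case False
  then show ?thesis
    using A_event[OF i] by (simp add: cond_expectation_def set_lebesgue_integral_def)
qed

lemma cond_expectation_mult_right:
  "cond_expectation \<Omega> (\<lambda>\<omega>. X \<omega> * c) E = cond_expectation \<Omega> X E * c" for c :: real
  by (simp add: cond_expectation_def)

lemma integrable_D_R:
  "i \<in> I \<Longrightarrow> integrable \<Omega> (\<lambda>\<omega>. g (D i \<omega>) (R i \<omega>) :: real)"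
  using integrable_observed[of i "\<lambda>d r _. g d r"] by simp

lemma expectation_D_R_cells:
  assumes "i \<in> I"
  shows "expectation (\<lambda>\<omega>. g (D i \<omega>) (R i \<omega>)) = (\<Sum>d\<in>{0, 1}. pI d *
    (\<Sum>(r, a)\<in>{0..n i} \<times> bin_vecs (n i). \<P>(\<omega> in \<Omega>. R i \<omega> = r \<and> A i \<omega> = a) * g d r))"
  using expectation_observed[of i "\<lambda>d r _. g d r", OF assms] prob_cell_const[OF assms]
  by (simp add: sum_distrib_left case_prod_beta mult.assoc)

text \<open>This is the independence of \<open>D i\<close> and \<open>R i\<close> in usable form.
  Each cell weight is \<open>pI d\<close> times a factor free of \<open>d\<close>; an integrand free
  of \<open>d\<close>, together with \<open>pI 0 + pI 1 = 1\<close>, identifies that factor as the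
  law of \<open>R i\<close>.\<close>

lemma expectation_D_R:
  assumes "i \<in> I"
  shows "expectation (\<lambda>\<omega>. g (D i \<omega>) (R i \<omega>)) = (\<Sum>d\<in>{0, 1}. pI d * expectation (\<lambda>\<omega>. g d (R i \<omega>)))"
proof -
  have "expectation (\<lambda>\<omega>. h (R i \<omega>)) =
      (\<Sum>(r, a)\<in>{0..n i} \<times> bin_vecs (n i). \<P>(\<omega> in \<Omega>. R i \<omega> = r \<and> A i \<omega> = a) * h r)" for h
    using expectation_D_R_cells[OF assms, of "\<lambda>_. h"] pI_sum[OF assms]
    by (simp flip: distrib_right)
  then show ?thesis using expectation_D_R_cells[OF assms] by simp
qed

lemma integrable_outcome_weighted:
  assumes "i \<in> I"
  shows "integrable \<Omega> (\<lambda>\<omega>. observed_outcome n peer D A Y i \<omega> * g (D i \<omega>) (R i \<omega>))"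
  using Y_integrable[OF assms] by (intro integrable_observed[of i "\<lambda>d r y. y * g d r"] assms) auto

lemma expectation_outcome_weighted:
  assumes "i \<in> I"
  shows "expectation (\<lambda>\<omega>. observed_outcome n peer D A Y i \<omega> * g (D i \<omega>) (R i \<omega>)) =
    (\<Sum>d\<in>{0, 1}. \<Sum>(r, a)\<in>{0..n i} \<times> bin_vecs (n i). pI d * \<P>(\<omega> in \<Omega>. R i \<omega> = r \<and> A i \<omega> = a) *
       (cond_expectation \<Omega> (Y i d r) {\<omega> \<in> space \<Omega>. A i \<omega> = a} * g d r))"
  using Y_integrable[OF assms]
  by (subst expectation_observed[of i "\<lambda>d r y. y * g d r"])
    (auto simp: assms cond_expectation_mult_right)

section \<open>Covariances of the outcome with the centred regressors\<close>

text \<open>The weights \<open>pI d * (real d - pI 1)\<close> are \<open>pI 0 * pI 1\<close> for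
  \<open>d = 1\<close> and its negative for \<open>d = 0\<close>, so the sum over \<open>d\<close>
  becomes a difference of potential outcomes.\<close>

lemma outcome_treatment_covariance:
  assumes i: "i \<in> I"
  shows "expectation (\<lambda>\<omega>. observed_outcome n peer D A Y i \<omega> * (real (D i \<omega>) - pI 1)) =
    pI 0 * pI 1 * (\<Sum>(r, a)\<in>{0..n i} \<times> bin_vecs (n i).
      cond_expectation \<Omega> (direct_effect Y i r) {\<omega> \<in> space \<Omega>. A i \<omega> = a} * \<P>(\<omega> in \<Omega>. R i \<omega> = r \<and> A i \<omega> = a))"
proof -
  have p: "pI 0 = 1 - pI 1" using pI_sum[OF i] by simp
  \<comment> \<open>Subtracting inside the integral needs both outcomes integrable, hence the
    restriction to exposures in \<open>{0..n i}\<close>.\<close>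
  have effect: "cond_expectation \<Omega> (direct_effect Y i r) {\<omega> \<in> space \<Omega>. A i \<omega> = a} =
      cond_expectation \<Omega> (Y i 1 r) {\<omega> \<in> space \<Omega>. A i \<omega> = a} -
      cond_expectation \<Omega> (Y i 0 r) {\<omega> \<in> space \<Omega>. A i \<omega> = a}" if "r \<in> {0..n i}" for r a
  proof -
    have "set_integrable \<Omega> {\<omega> \<in> space \<Omega>. A i \<omega> = a} (Y i d r)" if "d \<in> {0, 1}" for d
      unfolding set_integrable_def
      by (rule integrable_mult_indicator[OF A_event[OF i] Y_integrable[OF i that \<open>r \<in> _\<close>]])
    from set_integral_diff(2)[OF this this, of 1 0] show ?thesis
      by (simp add: cond_expectation_def direct_effect_def[abs_def] diff_divide_distrib)
  qed
  show ?thesis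
    unfolding expectation_outcome_weighted[OF i, of "\<lambda>d r. real d - pI 1"] sum_distrib_left
    by (simp add: p sum.distrib[symmetric] del: One_nat_def)
      (intro sum.cong refl, auto simp: effect algebra_simps simp del: One_nat_def)
qed

text \<open>The weight is free of \<open>d\<close>, so the sum over \<open>d\<close> averages
  \<open>Y i d r\<close> with weights \<open>pI d\<close>. Adding the mean baseline to the mean
  spillover effect cancels the outcomes at exposure 0 and leaves this same average.\<close>

lemma outcome_exposure_covariance:
  assumes i: "i \<in> I"
  shows "expectation (\<lambda>\<omega>. observed_outcome n peer D A Y i \<omega> * (M i (R i \<omega>) - \<mu>)) =
    (\<Sum>(r, a)\<in>{0..n i} \<times> bin_vecs (n i). (M i r - \<mu>) * \<P>(\<omega> in \<Omega>. R i \<omega> = r \<and> A i \<omega> = a) *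
      (cond_expectation \<Omega> (mean_spillover_effect Y pI i r) {\<omega> \<in> space \<Omega>. A i \<omega> = a} +
       cond_expectation \<Omega> (mean_baseline Y pI i) {\<omega> \<in> space \<Omega>. A i \<omega> = a}))"
proof -
  have effect: "cond_expectation \<Omega> (mean_spillover_effect Y pI i r) {\<omega> \<in> space \<Omega>. A i \<omega> = a} +
       cond_expectation \<Omega> (mean_baseline Y pI i) {\<omega> \<in> space \<Omega>. A i \<omega> = a} =
      cond_expectation \<Omega> (Y i 1 r) {\<omega> \<in> space \<Omega>. A i \<omega> = a} * pI 1 +
      cond_expectation \<Omega> (Y i 0 r) {\<omega> \<in> space \<Omega>. A i \<omega> = a} * pI 0" if r: "r \<in> {0..n i}" for r a
  proof -
    let ?E = "{\<omega> \<in> space \<Omega>. A i \<omega> = a}"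
    have *: "set_integrable \<Omega> ?E (Y i d s)" if "d \<in> {0, 1}" "s \<in> {0..n i}" for d s
      unfolding set_integrable_def
      by (rule integrable_mult_indicator[OF A_event[OF i] Y_integrable[OF i that]])
    have "(LINT \<omega>:?E|\<Omega>. mean_spillover_effect Y pI i r \<omega>) =
        ((LINT \<omega>:?E|\<Omega>. Y i 1 r \<omega>) - (LINT \<omega>:?E|\<Omega>. Y i 1 0 \<omega>)) * pI 1 +
        ((LINT \<omega>:?E|\<Omega>. Y i 0 r \<omega>) - (LINT \<omega>:?E|\<Omega>. Y i 0 0 \<omega>)) * pI 0"
      unfolding mean_spillover_effect_def spillover_effect_def
      using * r by (simp add: set_integral_add set_integral_diff)
    moreover have "(LINT \<omega>:?E|\<Omega>. mean_baseline Y pI i \<omega>) =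
        (LINT \<omega>:?E|\<Omega>. Y i 1 0 \<omega>) * pI 1 + (LINT \<omega>:?E|\<Omega>. Y i 0 0 \<omega>) * pI 0"
      unfolding mean_baseline_def using * by (simp add: set_integral_add)
    ultimately show ?thesis
      by (simp add: cond_expectation_def add_divide_distrib[symmetric] algebra_simps)
  qed
  show ?thesis
    unfolding expectation_outcome_weighted[OF i, of "\<lambda>d r. M i r - \<mu>"]
    by (simp add: sum.distrib[symmetric] del: One_nat_def)
      (intro sum.cong refl, clarsimp simp: effect simp del: One_nat_def, simp add: algebra_simps)
qed

section \<open>Expansion of the objective and normal equations\<close>

text \<open>A step \<open>t\<close> along the direction replaces the residual \<open>V i\<close> by
  \<open>V i - t * W i\<close>; expanding its square gives the polynomial that
  \<open>unique_min_along_line\<close> asks for.\<close>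

lemma ols_objective_along_line:
  fixes b0 bd bs h0 h1 h2 :: real
  defines "V \<equiv> \<lambda>i \<omega>. observed_outcome n peer D A Y i \<omega> - b0 - bd * real (D i \<omega>) - bs * M i (R i \<omega>)"
    and "W \<equiv> \<lambda>i \<omega>. h0 + h1 * real (D i \<omega>) + h2 * M i (R i \<omega>)"
  shows "ols_objective \<Omega> I n peer D A Y M ((b0, bd, bs) + t *\<^sub>R (h0, h1, h2)) =
    ols_objective \<Omega> I n peer D A Y M (b0, bd, bs)
      - 2 * t * (\<Sum>i\<in>I. expectation (\<lambda>\<omega>. V i \<omega> * W i \<omega>))
      + t\<^sup>2 * (\<Sum>i\<in>I. expectation (\<lambda>\<omega>. (W i \<omega>)\<^sup>2))"
proof -
  have "expectation (\<lambda>\<omega>. (V i \<omega> - t * W i \<omega>)\<^sup>2) = expectation (\<lambda>\<omega>. (V i \<omega>)\<^sup>2)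
      - 2 * t * expectation (\<lambda>\<omega>. V i \<omega> * W i \<omega>) + t\<^sup>2 * expectation (\<lambda>\<omega>. (W i \<omega>)\<^sup>2)" if i: "i \<in> I" for i
  proof -
    have sq: "integrable \<Omega> (\<lambda>\<omega>. (Y i d r \<omega> - b0 - bd * real d - bs * M i r)\<^sup>2)"
      if "d \<in> {0, 1}" "r \<in> {0..n i}" for d r
    proof -
      \<comment> \<open>For fixed \<open>d\<close> and \<open>r\<close> the fitted value is the
        constant \<open>c\<close>, so square integrability of the residual reduces to the first two
        moments of \<open>Y i d r\<close>.\<close>
      define c where "c = b0 + bd * real d + bs * M i r"
      have "integrable \<Omega> (\<lambda>\<omega>. (Y i d r \<omega>)\<^sup>2 - 2 * c * Y i d r \<omega> + c\<^sup>2)"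
        using Y_integrable[OF i that] Y_sq_integrable[OF i that] by simp
      also have "(\<lambda>\<omega>. (Y i d r \<omega>)\<^sup>2 - 2 * c * Y i d r \<omega> + c\<^sup>2) =
          (\<lambda>\<omega>. (Y i d r \<omega> - b0 - bd * real d - bs * M i r)\<^sup>2)"
        by (auto simp: c_def power2_eq_square algebra_simps)
      finally show ?thesis .
    qed
    have V2: "integrable \<Omega> (\<lambda>\<omega>. (V i \<omega>)\<^sup>2)"
      unfolding V_def using sq
      by (intro integrable_observed[of i "\<lambda>d r y. (y - b0 - bd * real d - bs * M i r)\<^sup>2"] i) auto
    have VW: "integrable \<Omega> (\<lambda>\<omega>. V i \<omega> * W i \<omega>)"
      unfolding V_def W_def using Y_integrable[OF i]
      by (intro integrable_observed[of i
            "\<lambda>d r y. (y - b0 - bd * real d - bs * M i r) * (h0 + h1 * real d + h2 * M i r)"] i) auto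
    have W2: "integrable \<Omega> (\<lambda>\<omega>. (W i \<omega>)\<^sup>2)"
      unfolding W_def
      using integrable_D_R[OF i, of "\<lambda>d r. (h0 + h1 * real d + h2 * M i r)\<^sup>2"] .
    have "expectation (\<lambda>\<omega>. (V i \<omega> - t * W i \<omega>)\<^sup>2) =
        expectation (\<lambda>\<omega>. (V i \<omega>)\<^sup>2 - 2 * t * (V i \<omega> * W i \<omega>) + t\<^sup>2 * (W i \<omega>)\<^sup>2)"
      by (simp add: power2_diff power_mult_distrib algebra_simps)
    then show ?thesis using V2 VW W2 by simp
  qed
  moreover have "observed_outcome n peer D A Y i \<omega> - (b0 + t * h0) - (bd + t * h1) * real (D i \<omega>)
      - (bs + t * h2) * M i (R i \<omega>) = V i \<omega> - t * W i \<omega>" for i \<omega>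
    by (simp add: V_def W_def algebra_simps)
  moreover have "observed_outcome n peer D A Y i \<omega> - b0 - bd * real (D i \<omega>)
      - bs * M i (R i \<omega>) = V i \<omega>" for i \<omega>
    by (simp add: V_def)
  ultimately show ?thesis
    by (simp add: ols_objective_def sum.distrib sum_subtractf sum_distrib_left)
qed

context
  fixes \<beta>0 \<beta>d \<beta>s :: real
  assumes ols_min: "is_arg_min (ols_objective \<Omega> I n peer D A Y M) (\<lambda>_. True) (\<beta>0, \<beta>d, \<beta>s)"
    and ols_unique: "\<And>b. is_arg_min (ols_objective \<Omega> I n peer D A Y M) (\<lambda>_. True) b \<Longrightarrow> b = (\<beta>0, \<beta>d, \<beta>s)"
begin

text \<open>The first claim is the vanishing derivative along the direction
  \<open>(h0, h1, h2)\<close>. The second is how uniqueness enters: it supplies the nonzero divisors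
  for both coefficients.\<close>

lemma normal_equation:
  assumes "(h0, h1, h2) \<noteq> (0, 0, 0)"
  shows "(\<Sum>i\<in>I. expectation (\<lambda>\<omega>. observed_outcome n peer D A Y i \<omega> * (h0 + h1 * real (D i \<omega>) + h2 * M i (R i \<omega>)))) =
      (\<Sum>i\<in>I. expectation (\<lambda>\<omega>. (\<beta>0 + \<beta>d * real (D i \<omega>) + \<beta>s * M i (R i \<omega>)) * (h0 + h1 * real (D i \<omega>) + h2 * M i (R i \<omega>))))"
    and "(\<Sum>i\<in>I. expectation (\<lambda>\<omega>. (h0 + h1 * real (D i \<omega>) + h2 * M i (R i \<omega>))\<^sup>2)) \<noteq> 0"
proof -
  have h: "(h0, h1, h2) \<noteq> 0" using assms by (simp add: zero_prod_def)
  note opt = unique_min_along_line[OF ols_objective_along_line ols_min ols_unique h]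
  have "expectation (\<lambda>\<omega>. (observed_outcome n peer D A Y i \<omega> - \<beta>0 - \<beta>d * real (D i \<omega>) - \<beta>s * M i (R i \<omega>)) *
        (h0 + h1 * real (D i \<omega>) + h2 * M i (R i \<omega>))) =
      expectation (\<lambda>\<omega>. observed_outcome n peer D A Y i \<omega> * (h0 + h1 * real (D i \<omega>) + h2 * M i (R i \<omega>))) -
      expectation (\<lambda>\<omega>. (\<beta>0 + \<beta>d * real (D i \<omega>) + \<beta>s * M i (R i \<omega>)) * (h0 + h1 * real (D i \<omega>) + h2 * M i (R i \<omega>)))"
    if i: "i \<in> I" for i
    by (subst Bochner_Integration.integral_diff[symmetric, OF
          integrable_outcome_weighted[OF i, of "\<lambda>d r. h0 + h1 * real d + h2 * M i r"]
          integrable_D_R[OF i, of "\<lambda>d r. (\<beta>0 + \<beta>d * real d + \<beta>s * M i r) * (h0 + h1 * real d + h2 * M i r)"]])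
      (simp add: algebra_simps)
  with opt(1) show "(\<Sum>i\<in>I. expectation (\<lambda>\<omega>. observed_outcome n peer D A Y i \<omega> * (h0 + h1 * real (D i \<omega>) + h2 * M i (R i \<omega>)))) =
      (\<Sum>i\<in>I. expectation (\<lambda>\<omega>. (\<beta>0 + \<beta>d * real (D i \<omega>) + \<beta>s * M i (R i \<omega>)) * (h0 + h1 * real (D i \<omega>) + h2 * M i (R i \<omega>))))"
    by (simp add: sum_subtractf)
  show "(\<Sum>i\<in>I. expectation (\<lambda>\<omega>. (h0 + h1 * real (D i \<omega>) + h2 * M i (R i \<omega>))\<^sup>2)) \<noteq> 0"
    by (rule opt(2))
qed

section \<open>Solving for the two coefficients\<close>

text \<open>Tested against \<open>D i - pI 1\<close>, the normal equation involves \<beta>d alone,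
  and both sides carry the treatment variance \<open>pI 0 * pI 1\<close>, which cancels.\<close>

lemma ols_treatment_coefficient:
  "\<beta>d = 1 / real (card I) * (\<Sum>i\<in>I. \<Sum>(r, a)\<in>{0..n i} \<times> bin_vecs (n i).
     cond_expectation \<Omega> (direct_effect Y i r) {\<omega> \<in> space \<Omega>. A i \<omega> = a} * \<P>(\<omega> in \<Omega>. R i \<omega> = r \<and> A i \<omega> = a))"
proof -
  let ?S = "\<lambda>i. \<Sum>(r, a)\<in>{0..n i} \<times> bin_vecs (n i).
     cond_expectation \<Omega> (direct_effect Y i r) {\<omega> \<in> space \<Omega>. A i \<omega> = a} * \<P>(\<omega> in \<Omega>. R i \<omega> = r \<and> A i \<omega> = a)"
  note ne = normal_equation[of "- pI 1" 1 0, simplified]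
  have var: "expectation (\<lambda>\<omega>. (real (D i \<omega>) - pI 1)\<^sup>2) = pI 0 * pI 1" if i: "i \<in> I" for i
  proof -
    have p: "pI 0 = 1 - pI 1" using pI_sum[OF i] by simp
    show ?thesis
      by (subst expectation_D_R[OF i, of "\<lambda>d r. (real d - pI 1)\<^sup>2"])
        (simp add: prob_space p power2_eq_square algebra_simps)
  qed
  \<comment> \<open>The mean of \<open>D i - pI 1\<close> is 0, and stays 0 after multiplication by
    a function of the independent \<open>R i\<close>. This removes \<beta>0 and \<beta>s and leaves
    \<beta>d times the variance.\<close>
  have cov: "expectation (\<lambda>\<omega>. (\<beta>0 + \<beta>d * real (D i \<omega>) + \<beta>s * M i (R i \<omega>)) * (real (D i \<omega>) - pI 1)) =
      pI 0 * pI 1 * \<beta>d" if i: "i \<in> I" for i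
  proof -
    have M: "integrable \<Omega> (\<lambda>\<omega>. M i (R i \<omega>))" by (rule integrable_D_R[OF i])
    have p: "pI 0 = 1 - pI 1" using pI_sum[OF i] by simp
    show ?thesis
      using expectation_D_R[OF i, of "\<lambda>d r. (\<beta>0 + \<beta>d * real d + \<beta>s * M i r) * (real d - pI 1)"] M
      by (simp add: prob_space p algebra_simps)
  qed
  \<comment> \<open>This product is the quadratic coefficient along the direction, so uniqueness
    excludes an empty focal sample and a degenerate treatment.\<close>
  have "real (card I) * (pI 0 * pI 1) \<noteq> 0"
    using ne(2) var by (simp add: algebra_simps)
  moreover have "(\<Sum>i\<in>I. pI 0 * pI 1 * ?S i) = (\<Sum>i\<in>I. pI 0 * pI 1 * \<beta>d)"
    using ne(1) cov outcome_treatment_covariance by (simp add: algebra_simps)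
  then have "pI 0 * pI 1 * (\<Sum>i\<in>I. ?S i) = real (card I) * (pI 0 * pI 1 * \<beta>d)"
    by (simp add: sum_distrib_left)
  ultimately show ?thesis by (simp add: field_simps)
qed

text \<open>Since \<open>D i\<close> is independent of \<open>R i\<close> and has mean
  \<open>pI 1\<close> in every unit, its contribution is a fixed multiple of the summed deviations
  of the exposures from \<mu>, and that sum is 0.\<close>

lemma ols_exposure_coefficient:
  "\<beta>s = 1 / real (card I) * (\<Sum>i\<in>I. \<Sum>(r, a)\<in>{0..n i} \<times> bin_vecs (n i).
     exposure_weight \<Omega> I R A M i r a *
     (cond_expectation \<Omega> (mean_spillover_effect Y pI i r) {\<omega> \<in> space \<Omega>. A i \<omega> = a} +
      cond_expectation \<Omega> (mean_baseline Y pI i) {\<omega> \<in> space \<Omega>. A i \<omega> = a}))"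
proof -
  let ?c = "\<lambda>i r a. cond_expectation \<Omega> (mean_spillover_effect Y pI i r) {\<omega> \<in> space \<Omega>. A i \<omega> = a} +
      cond_expectation \<Omega> (mean_baseline Y pI i) {\<omega> \<in> space \<Omega>. A i \<omega> = a}"
  define \<mu> where "\<mu> = mean_exposure \<Omega> I R M"
  define v where "v = (\<Sum>i\<in>I. expectation (\<lambda>\<omega>. (M i (R i \<omega>) - \<mu>)\<^sup>2))"
  note ne = normal_equation[of "- \<mu>" 0 1, simplified]
  have v: "v \<noteq> 0" using ne(2) by (simp add: v_def)
  \<comment> \<open>An empty focal sample would make \<open>v\<close> an empty sum, so division by
    \<open>card I\<close> is legitimate.\<close>
  then have I: "real (card I) \<noteq> 0" using finite_focal by (auto simp: v_def)
  have M: "integrable \<Omega> (\<lambda>\<omega>. M i (R i \<omega>) - \<mu>)" "integrable \<Omega> (\<lambda>\<omega>. (M i (R i \<omega>) - \<mu>)\<^sup>2)"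
    "integrable \<Omega> (\<lambda>\<omega>. M i (R i \<omega>))" if i: "i \<in> I" for i
    using integrable_D_R[OF i, of "\<lambda>_ r. M i r - \<mu>"] integrable_D_R[OF i, of "\<lambda>_ r. (M i r - \<mu>)\<^sup>2"]
      integrable_D_R[OF i, of "\<lambda>_ r. M i r"] by auto
  \<comment> \<open>Only the sum is centred: \<mu> averages the means of all units, and a single
    unit may deviate from it.\<close>
  have centred: "(\<Sum>i\<in>I. expectation (\<lambda>\<omega>. M i (R i \<omega>) - \<mu>)) = 0"
  proof -
    have "(\<Sum>i\<in>I. expectation (\<lambda>\<omega>. M i (R i \<omega>) - \<mu>)) = (\<Sum>i\<in>I. expectation (\<lambda>\<omega>. M i (R i \<omega>))) - real (card I) * \<mu>"
      using M(3) by (simp add: prob_space sum_subtractf)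
    then show ?thesis using I by (simp add: \<mu>_def mean_exposure_def)
  qed
  \<comment> \<open>The factor of the first expectation on the right is the same for all
    \<open>i\<close>, so it can leave the sum over \<open>i\<close>, where \<open>centred\<close>
    removes it.\<close>
  have cov: "expectation (\<lambda>\<omega>. (\<beta>0 + \<beta>d * real (D i \<omega>) + \<beta>s * M i (R i \<omega>)) * (M i (R i \<omega>) - \<mu>)) =
      (\<beta>0 + \<beta>d * pI 1 + \<beta>s * \<mu>) * expectation (\<lambda>\<omega>. M i (R i \<omega>) - \<mu>) +
      \<beta>s * expectation (\<lambda>\<omega>. (M i (R i \<omega>) - \<mu>)\<^sup>2)" if i: "i \<in> I" for i
  proof -
    \<comment> \<open>With the treatment held at \<open>d\<close>, writing the exposure as \<mu>
      plus its deviation separates a linear and a quadratic term; averaging over \<open>d\<close>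
      then replaces \<open>d\<close> by \<open>pI 1\<close>.\<close>
    have *: "expectation (\<lambda>\<omega>. (\<beta>0 + \<beta>d * real d + \<beta>s * M i (R i \<omega>)) * (M i (R i \<omega>) - \<mu>)) =
        (\<beta>0 + \<beta>d * real d + \<beta>s * \<mu>) * expectation (\<lambda>\<omega>. M i (R i \<omega>) - \<mu>) +
        \<beta>s * expectation (\<lambda>\<omega>. (M i (R i \<omega>) - \<mu>)\<^sup>2)" for d :: nat
    proof -
      have "expectation (\<lambda>\<omega>. (\<beta>0 + \<beta>d * real d + \<beta>s * M i (R i \<omega>)) * (M i (R i \<omega>) - \<mu>)) =
          expectation (\<lambda>\<omega>. (\<beta>0 + \<beta>d * real d + \<beta>s * \<mu>) * (M i (R i \<omega>) - \<mu>) + \<beta>s * (M i (R i \<omega>) - \<mu>)\<^sup>2)"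
        by (simp add: power2_eq_square algebra_simps)
      then show ?thesis
        by (simp only: Bochner_Integration.integral_add integrable_mult_right M i integral_mult_right_zero)
    qed
    have p: "pI 0 = 1 - pI 1" using pI_sum[OF i] by simp
    show ?thesis
      using expectation_D_R[OF i, of "\<lambda>d r. (\<beta>0 + \<beta>d * real d + \<beta>s * M i r) * (M i r - \<mu>)"]
      unfolding * by (simp add: p algebra_simps)
  qed
  have "(\<Sum>i\<in>I. \<Sum>(r, a)\<in>{0..n i} \<times> bin_vecs (n i). (M i r - \<mu>) * \<P>(\<omega> in \<Omega>. R i \<omega> = r \<and> A i \<omega> = a) * ?c i r a) =
      (\<Sum>i\<in>I. expectation (\<lambda>\<omega>. observed_outcome n peer D A Y i \<omega> * (M i (R i \<omega>) - \<mu>)))"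
    by (intro sum.cong refl) (simp only: outcome_exposure_covariance)
  also have "\<dots> = (\<Sum>i\<in>I. expectation (\<lambda>\<omega>. (\<beta>0 + \<beta>d * real (D i \<omega>) + \<beta>s * M i (R i \<omega>)) * (M i (R i \<omega>) - \<mu>)))"
    using ne(1) by simp
  also have "\<dots> = (\<Sum>i\<in>I. (\<beta>0 + \<beta>d * pI 1 + \<beta>s * \<mu>) * expectation (\<lambda>\<omega>. M i (R i \<omega>) - \<mu>) +
      \<beta>s * expectation (\<lambda>\<omega>. (M i (R i \<omega>) - \<mu>)\<^sup>2))"
    by (intro sum.cong refl cov)
  also have "\<dots> = (\<beta>0 + \<beta>d * pI 1 + \<beta>s * \<mu>) * (\<Sum>i\<in>I. expectation (\<lambda>\<omega>. M i (R i \<omega>) - \<mu>)) + \<beta>s * v"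
    unfolding v_def sum.distrib sum_distrib_left ..
  finally have main: "(\<Sum>i\<in>I. \<Sum>(r, a)\<in>{0..n i} \<times> bin_vecs (n i).
      (M i r - \<mu>) * \<P>(\<omega> in \<Omega>. R i \<omega> = r \<and> A i \<omega> = a) * ?c i r a) = \<beta>s * v"
    unfolding centred by simp
  \<comment> \<open>The leading \<open>1 / real (card I)\<close> cancels the one in the denominator
    of \<open>exposure_weight\<close>, leaving division by \<open>v\<close>.\<close>
  have "1 / real (card I) * (\<Sum>i\<in>I. \<Sum>(r, a)\<in>{0..n i} \<times> bin_vecs (n i). exposure_weight \<Omega> I R A M i r a * ?c i r a) =
      (\<Sum>i\<in>I. \<Sum>(r, a)\<in>{0..n i} \<times> bin_vecs (n i). (M i r - \<mu>) * \<P>(\<omega> in \<Omega>. R i \<omega> = r \<and> A i \<omega> = a) * ?c i r a) / v"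
    unfolding sum_distrib_left sum_divide_distrib
    using I by (intro sum.cong refl)
      (simp add: exposure_weight_def case_prod_beta flip: \<mu>_def v_def)
  also have "\<dots> = \<beta>s" unfolding main using v by simp
  finally show ?thesis by simp
qed

end

end

section \<open>Transfer of both coefficient formulas to the stated hypotheses\<close>

theorem theorem3p1:
  fixes \<Omega> :: "'w measure"
    and I J :: "'u set"
    and n :: "'u \<Rightarrow> nat"
    and peer :: "'u \<Rightarrow> nat \<Rightarrow> 'u"
    and D :: "'u \<Rightarrow> 'w \<Rightarrow> nat"
    and A :: "'u \<Rightarrow> 'w \<Rightarrow> (nat \<Rightarrow> nat)"
    and Y :: "'u \<Rightarrow> nat \<Rightarrow> nat \<Rightarrow> 'w \<Rightarrow> real"
    and M :: "'u \<Rightarrow> nat \<Rightarrow> real"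
    and pI pJ :: "nat \<Rightarrow> real"
    and \<beta>0 \<beta>d \<beta>s :: real
  assumes model: "network_model \<Omega> I J n peer D A Y M"
    and treatments_indep:
      "prob_space.indep_vars \<Omega> (\<lambda>_. count_space {0, 1}) D (I \<union> J)"
    and prob_focal: "\<And>i d. i \<in> I \<Longrightarrow> d \<in> {0, 1} \<Longrightarrow> \<P>(\<omega> in \<Omega>. D i \<omega> = d) = pI d"
    and prob_peer: "\<And>j d. j \<in> J \<Longrightarrow> d \<in> {0, 1} \<Longrightarrow> \<P>(\<omega> in \<Omega>. D j \<omega> = d) = pJ d"
    and randomization:
      "\<And>i d r. i \<in> I \<Longrightarrow> d \<in> {0, 1} \<Longrightarrow> r \<in> {0..n i} \<Longrightarrow>
         prob_space.indep_var \<Omega>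
           (count_space {0, 1} \<Otimes>\<^sub>M count_space (bin_vecs (n i)))
           (\<lambda>\<omega>. (real (D i \<omega>), peer_treatments n peer D i \<omega>))
           (borel \<Otimes>\<^sub>M count_space (bin_vecs (n i)))
           (\<lambda>\<omega>. (Y i d r \<omega>, A i \<omega>))"
    and units_indep:
      "prob_space.indep_vars \<Omega>
         (\<lambda>i. (\<Pi>\<^sub>M x\<in>{0, 1} \<times> {0..n i}. borel) \<Otimes>\<^sub>M count_space (bin_vecs (n i)))
         (\<lambda>i \<omega>. (restrict (\<lambda>(d, r). Y i d r \<omega>) ({0, 1} \<times> {0..n i}), A i \<omega>)) I"
    and ols_min:
      "is_arg_min (ols_objective \<Omega> I n peer D A Y M) (\<lambda>_. True) (\<beta>0, \<beta>d, \<beta>s)"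
    and ols_unique:
      "\<And>b. is_arg_min (ols_objective \<Omega> I n peer D A Y M) (\<lambda>_. True) b \<Longrightarrow> b = (\<beta>0, \<beta>d, \<beta>s)"
  shows "\<beta>d = 1 / real (card I) *
           (\<Sum>i\<in>I. \<Sum>(r, a)\<in>{0..n i} \<times> bin_vecs (n i).
              cond_expectation \<Omega> (direct_effect Y i r) {\<omega> \<in> space \<Omega>. A i \<omega> = a} *
              \<P>(\<omega> in \<Omega>. treated_peers n peer D A i \<omega> = r \<and> A i \<omega> = a))
         \<and> \<beta>s = 1 / real (card I) *
           (\<Sum>i\<in>I. \<Sum>(r, a)\<in>{0..n i} \<times> bin_vecs (n i).
              exposure_weight \<Omega> I (treated_peers n peer D A) A M i r a *
              (cond_expectation \<Omega> (mean_spillover_effect Y pI i r) {\<omega> \<in> space \<Omega>. A i \<omega> = a} +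
               cond_expectation \<Omega> (mean_baseline Y pI i) {\<omega> \<in> space \<Omega>. A i \<omega> = a}))"
proof -
  interpret network_model \<Omega> I J n peer D A Y M by (rule model)
  interpret randomized_network \<Omega> I J n peer D A Y M pI
    by unfold_locales (fact treatments_indep prob_focal randomization)+
  show ?thesis
    using ols_treatment_coefficient[OF ols_min ols_unique] ols_exposure_coefficient[OF ols_min ols_unique]
    by blast
qed

end
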